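(* Let $i\in\{1,2\}$, $\varepsilon=(-1)^i$, let $\lambda,\mu\in\mathbb{R}$ be not both zero, and equip $\mathbb{E}_1^4$ with the density $e^{\lambda(x^2+y^2)+\mu(z^2-t^2)}$. Let $\mathcal{S}_i$ be a timelike general rotational surface of first type ($i=1$) or second type ($i=2$) determined by $f,g,\alpha,\beta$ whose meridian curve is parametrized with $f(u)=u$, i.e. the meridian curve is $c_1:x_1(u)=(u,0,g(u),0)$ for $\mathcal{S}_1$ and $c_2:x_2(u)=(u,0,0,g(u))$ for $\mathcal{S}_2$. Then $\mathcal{S}_i$ is weighted minimal if and only if $g$ is a solution on $J$ of the differential equation $$\left(\arctan(g'(u))\right)'=A_1\quad\text{for }\mathcal{S}_1,\qquad\left(\log\left|\frac{1-g'(u)}{1+g'(u)}\right|\right)'=2A_1\quad\text{for }\mathcal{S}_2,$$ where $$A_1=\frac{2\left(\lambda ug'(u)-\mu g(u)\right)\left((\alpha u)^2+\varepsilon(\beta g(u))^2\right)+\varepsilon\left(\beta^2g(u)+\alpha^2ug'(u)\right)}{(\alpha u)^2+\varepsilon(\beta g(u))^2}.$$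
   Context: $\mathbb{E}_1^4$ is $\mathbb{R}^4$ with coordinates $(x,y,z,t)$ and the metric $\langle\,,\rangle=dx^2+dy^2+dz^2-dt^2$. Let $\alpha,\beta>0$ be constants, $J\subset\mathbb{R}$ an open interval, $f,g:J\to\mathbb{R}$ smooth functions of $u$ (primes denote $d/du$), and $v\in[0,2\pi)$. First type: $\mathcal{S}_1: X_1(u,v)=(f\cos(\alpha v),f\sin(\alpha v),g\cosh(\beta v),g\sinh(\beta v))$ with $\alpha^2f^2-\beta^2g^2<0$ and $f'^2+g'^2>0$ on $J$; its meridian curve is $u\mapsto(f(u),0,g(u),0)$. Second type: $\mathcal{S}_2: X_2(u,v)=(f\cos(\alpha v),f\sin(\alpha v),g\sinh(\beta v),g\cosh(\beta v))$ with $f'^2-g'^2<0$ and $\alpha^2f^2+\beta^2g^2>0$ on $J$; its meridian curve is $u\mapsto(f(u),0,0,g(u))$. Both surfaces are timelike. Normal frame of $\mathcal{S}_1$: $n_1^{\mathcal{S}_1}=\frac{1}{\sqrt{f'^2+g'^2}}(g'\cos(\alpha v),g'\sin(\alpha v),-f'\cosh(\beta v),-f'\sinh(\beta v))$, $n_2^{\mathcal{S}_1}=\frac{1}{\sqrt{(\beta g)^2-(\alpha f)^2}}(-\beta g\sin(\alpha v),\beta g\cos(\alpha v),\alpha f\sinh(\beta v),\alpha f\cosh(\beta v))$. Normal frame of $\mathcal{S}_2$: $n_1^{\mathcal{S}_2}=\frac{1}{\sqrt{(\alpha f)^2+(\beta g)^2}}(\beta g\sin(\alpha v),-\beta g\cos(\alpha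 v),\alpha f\cosh(\beta v),\alpha f\sinh(\beta v))$, $n_2^{\mathcal{S}_2}=\frac{1}{\sqrt{g'^2-f'^2}}(g'\cos(\alpha v),g'\sin(\alpha v),f'\sinh(\beta v),f'\cosh(\beta v))$. With $\varepsilon=(-1)^i$, the $j$-th mean curvatures of $\mathcal{S}_i$ ($j\in\{1,2\}$) are the functions $H_j^{\mathcal{S}_i}=0$ if $j\neq i$, and $$H_i^{\mathcal{S}_i}=\frac{(f'g''-f''g')\left((\alpha f)^2+\varepsilon(\beta g)^2\right)-\varepsilon(\alpha^2fg'+\beta^2gf')(-\varepsilon f'^2+g'^2)}{2(-\varepsilon f'^2+g'^2)^{3/2}\left((\alpha f)^2+\varepsilon(\beta g)^2\right)}.$$ For a density $e^\phi$, the $j$-th weighted mean curvature function is $(H_j^{\mathcal{S}_i})_\phi=H_j^{\mathcal{S}_i}-\frac12\frac{d\phi}{dn_j^{\mathcal{S}_i}}$, where $\frac{d\phi}{dn}=d\phi(n)$ is the directional derivative of $\phi$ along $n$ at the point of the surface. The weighted mean curvature vector field is $\overrightarrow{H_\phi^{\mathcal{S}_i}}=(H_1^{\mathcal{S}_i})_\phi n_1^{\mathcal{S}_i}+(H_2^{\mathcal{S}_i})_\phi n_2^{\mathcal{S}_i}$ and the weighted mean curvature is $H_\phi^{\mathcal{S}_i}=\|\overrightarrow{H_\phi^{\mathcal{S}_i}}\|$, with $\|V\|=\sqrt{|\langle V,V\rangle|}$. The surface is weighted minimal if $H_\phi^{\mathcal{S}_i}$ vanishes identically. *)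

theory Defs
  imports "HOL-Analysis.Analysis"
begin

text \<open>Minkowski space is \<^typ>\<open>real ^ 4\<close> with coordinates \<open>(x, y, z, t)\<close>
  at the indices \<open>1, 2, 3, 4\<close>.\<close>

definition lorentz :: "real ^ 4 \<Rightarrow> real ^ 4 \<Rightarrow> real" where
  "lorentz p q = p $ 1 * q $ 1 + p $ 2 * q $ 2 + p $ 3 * q $ 3 - p $ 4 * q $ 4"

definition lorentz_norm :: "real ^ 4 \<Rightarrow> real" where
  "lorentz_norm p = sqrt \<bar>lorentz p p\<bar>"

text \<open>Throughout, \<open>i\<close> is the type of the surface and ranges over \<open>{1, 2}\<close>;
  \<open>j \<in> {1, 2}\<close> numbers the normals.\<close>

definition eps :: "nat \<Rightarrow> real" where
  "eps i = (-1) ^ i"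

definition smooth_on_reals :: "real set \<Rightarrow> (real \<Rightarrow> real) \<Rightarrow> bool" where
  "smooth_on_reals J f \<longleftrightarrow> (\<forall>k. (deriv ^^ k) f differentiable_on J)"

definition rot_surface ::
    "nat \<Rightarrow> real \<Rightarrow> real \<Rightarrow> (real \<Rightarrow> real) \<Rightarrow> (real \<Rightarrow> real) \<Rightarrow> real \<Rightarrow> real \<Rightarrow> real ^ 4" where
  "rot_surface i \<alpha> \<beta> f g u v =
     (if i = 1
      then vector [f u * cos (\<alpha> * v), f u * sin (\<alpha> * v),
                   g u * cosh (\<beta> * v), g u * sinh (\<beta> * v)]
      else vector [f u * cos (\<alpha> * v), f u * sin (\<alpha> * v),
                   g u * sinh (\<beta> * v), g u * cosh (\<beta> * v)])"

text \<open>The two inequalities for each type make the induced metric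
  \<open>(f'\<^sup>2 + g'\<^sup>2) du\<^sup>2 + (\<alpha>\<^sup>2 f\<^sup>2 - \<beta>\<^sup>2 g\<^sup>2) dv\<^sup>2\<close>, respectively
  \<open>(f'\<^sup>2 - g'\<^sup>2) du\<^sup>2 + (\<alpha>\<^sup>2 f\<^sup>2 + \<beta>\<^sup>2 g\<^sup>2) dv\<^sup>2\<close>, Lorentzian,
  so the surface is timelike.\<close>

definition timelike_rotational ::
    "nat \<Rightarrow> real \<Rightarrow> real \<Rightarrow> real set \<Rightarrow> (real \<Rightarrow> real) \<Rightarrow> (real \<Rightarrow> real) \<Rightarrow> bool" where
  "timelike_rotational i \<alpha> \<beta> J f g \<longleftrightarrow>
     0 < \<alpha> \<and> 0 < \<beta> \<and> open J \<and> is_interval J \<and> J \<noteq> {} \<and>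
     smooth_on_reals J f \<and> smooth_on_reals J g \<and>
     (\<forall>u\<in>J.
        if i = 1
        then \<alpha>\<^sup>2 * (f u)\<^sup>2 - \<beta>\<^sup>2 * (g u)\<^sup>2 < 0 \<and> (deriv f u)\<^sup>2 + (deriv g u)\<^sup>2 > 0
        else (deriv f u)\<^sup>2 - (deriv g u)\<^sup>2 < 0 \<and> \<alpha>\<^sup>2 * (f u)\<^sup>2 + \<beta>\<^sup>2 * (g u)\<^sup>2 > 0)"

definition normal_first ::
    "nat \<Rightarrow> real \<Rightarrow> real \<Rightarrow> (real \<Rightarrow> real) \<Rightarrow> (real \<Rightarrow> real) \<Rightarrow> real \<Rightarrow> real \<Rightarrow> real ^ 4" where
  "normal_first j \<alpha> \<beta> f g u v =
     (if j = 1
      then (1 / sqrt ((deriv f u)\<^sup>2 + (deriv g u)\<^sup>2)) *\<^sub>R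
           vector [deriv g u * cos (\<alpha> * v), deriv g u * sin (\<alpha> * v),
                   - deriv f u * cosh (\<beta> * v), - deriv f u * sinh (\<beta> * v)]
      else (1 / sqrt ((\<beta> * g u)\<^sup>2 - (\<alpha> * f u)\<^sup>2)) *\<^sub>R
           vector [- \<beta> * g u * sin (\<alpha> * v), \<beta> * g u * cos (\<alpha> * v),
                   \<alpha> * f u * sinh (\<beta> * v), \<alpha> * f u * cosh (\<beta> * v)])"

definition normal_second ::
    "nat \<Rightarrow> real \<Rightarrow> real \<Rightarrow> (real \<Rightarrow> real) \<Rightarrow> (real \<Rightarrow> real) \<Rightarrow> real \<Rightarrow> real \<Rightarrow> real ^ 4" where
  "normal_second j \<alpha> \<beta> f g u v =
     (if j = 1
      then (1 / sqrt ((\<alpha> * f u)\<^sup>2 + (\<beta> * g u)\<^sup>2)) *\<^sub>R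
           vector [\<beta> * g u * sin (\<alpha> * v), - \<beta> * g u * cos (\<alpha> * v),
                   \<alpha> * f u * cosh (\<beta> * v), \<alpha> * f u * sinh (\<beta> * v)]
      else (1 / sqrt ((deriv g u)\<^sup>2 - (deriv f u)\<^sup>2)) *\<^sub>R
           vector [deriv g u * cos (\<alpha> * v), deriv g u * sin (\<alpha> * v),
                   deriv f u * sinh (\<beta> * v), deriv f u * cosh (\<beta> * v)])"

definition normal ::
    "nat \<Rightarrow> nat \<Rightarrow> real \<Rightarrow> real \<Rightarrow> (real \<Rightarrow> real) \<Rightarrow> (real \<Rightarrow> real) \<Rightarrow> real \<Rightarrow> real \<Rightarrow> real ^ 4" where
  "normal i j = (if i = 1 then normal_first j else normal_second j)"

definition mean_curv ::
    "nat \<Rightarrow> nat \<Rightarrow> real \<Rightarrow> real \<Rightarrow> (real \<Rightarrow> real) \<Rightarrow> (real \<Rightarrow> real) \<Rightarrow> real \<Rightarrow> real" where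
  "mean_curv i j \<alpha> \<beta> f g u =
     (if j \<noteq> i then 0
      else ((deriv f u * deriv (deriv g) u - deriv (deriv f) u * deriv g u)
              * ((\<alpha> * f u)\<^sup>2 + eps i * (\<beta> * g u)\<^sup>2)
            - eps i * (\<alpha>\<^sup>2 * f u * deriv g u + \<beta>\<^sup>2 * g u * deriv f u)
              * (- eps i * (deriv f u)\<^sup>2 + (deriv g u)\<^sup>2))
           / (2 * (- eps i * (deriv f u)\<^sup>2 + (deriv g u)\<^sup>2) powr (3 / 2)
              * ((\<alpha> * f u)\<^sup>2 + eps i * (\<beta> * g u)\<^sup>2)))"

text \<open>The argument \<open>\<phi>\<close> is the exponent of the density \<open>e\<^sup>\<phi>\<close>.\<close>

definition weighted_mean_curv_fun ::
    "(real ^ 4 \<Rightarrow> real) \<Rightarrow> nat \<Rightarrow> nat \<Rightarrow> real \<Rightarrow> real \<Rightarrow> (real \<Rightarrow> real) \<Rightarrow> (real \<Rightarrow> real)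
      \<Rightarrow> real \<Rightarrow> real \<Rightarrow> real" where
  "weighted_mean_curv_fun \<phi> i j \<alpha> \<beta> f g u v =
     mean_curv i j \<alpha> \<beta> f g u
     - 1 / 2 * frechet_derivative \<phi> (at (rot_surface i \<alpha> \<beta> f g u v)) (normal i j \<alpha> \<beta> f g u v)"

definition weighted_mean_curv_vector ::
    "(real ^ 4 \<Rightarrow> real) \<Rightarrow> nat \<Rightarrow> real \<Rightarrow> real \<Rightarrow> (real \<Rightarrow> real) \<Rightarrow> (real \<Rightarrow> real)
      \<Rightarrow> real \<Rightarrow> real \<Rightarrow> real ^ 4" where
  "weighted_mean_curv_vector \<phi> i \<alpha> \<beta> f g u v =
     weighted_mean_curv_fun \<phi> i 1 \<alpha> \<beta> f g u v *\<^sub>R normal i 1 \<alpha> \<beta> f g u v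
     + weighted_mean_curv_fun \<phi> i 2 \<alpha> \<beta> f g u v *\<^sub>R normal i 2 \<alpha> \<beta> f g u v"

definition weighted_mean_curv ::
    "(real ^ 4 \<Rightarrow> real) \<Rightarrow> nat \<Rightarrow> real \<Rightarrow> real \<Rightarrow> (real \<Rightarrow> real) \<Rightarrow> (real \<Rightarrow> real)
      \<Rightarrow> real \<Rightarrow> real \<Rightarrow> real" where
  "weighted_mean_curv \<phi> i \<alpha> \<beta> f g u v =
     lorentz_norm (weighted_mean_curv_vector \<phi> i \<alpha> \<beta> f g u v)"

definition weighted_minimal ::
    "(real ^ 4 \<Rightarrow> real) \<Rightarrow> nat \<Rightarrow> real \<Rightarrow> real \<Rightarrow> real set \<Rightarrow> (real \<Rightarrow> real) \<Rightarrow> (real \<Rightarrow> real)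
      \<Rightarrow> bool" where
  "weighted_minimal \<phi> i \<alpha> \<beta> J f g \<longleftrightarrow>
     (\<forall>u\<in>J. \<forall>v\<in>{0..<2 * pi}. weighted_mean_curv \<phi> i \<alpha> \<beta> f g u v = 0)"

definition quadratic_exponent :: "real \<Rightarrow> real \<Rightarrow> real ^ 4 \<Rightarrow> real" where
  "quadratic_exponent lam \<mu> p =
     lam * ((p $ 1)\<^sup>2 + (p $ 2)\<^sup>2) + \<mu> * ((p $ 3)\<^sup>2 - (p $ 4)\<^sup>2)"

definition A1 ::
    "nat \<Rightarrow> real \<Rightarrow> real \<Rightarrow> real \<Rightarrow> real \<Rightarrow> (real \<Rightarrow> real) \<Rightarrow> real \<Rightarrow> real" where
  "A1 i lam \<mu> \<alpha> \<beta> g u =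
     (2 * (lam * u * deriv g u - \<mu> * g u) * ((\<alpha> * u)\<^sup>2 + eps i * (\<beta> * g u)\<^sup>2)
      + eps i * (\<beta>\<^sup>2 * g u + \<alpha>\<^sup>2 * u * deriv g u))
     / ((\<alpha> * u)\<^sup>2 + eps i * (\<beta> * g u)\<^sup>2)"

end

theory Submission
  imports Defs
begin

text \<open>
  Write \<open>n\<^sub>i\<close> for the normal of \<open>S\<^sub>i\<close> that carries the same number as the surface. It lies in the
  rotated and boosted meridian plane; the other normal is orthogonal to that plane, which contains
  the gradients of \<open>x\<^sup>2 + y\<^sup>2\<close> and \<open>z\<^sup>2 - t\<^sup>2\<close>. The exponent of the density is a function of these two
  quantities, so its derivative along the other normal is zero
  (\<open>normal_other_annihilates_quadratic_exponent\<close>). As the mean curvature in that direction is zero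
  as well, the weighted mean curvature vector is a multiple of \<open>n\<^sub>i\<close>. This matters because the norm
  of an indefinite metric also vanishes on nonzero lightlike vectors: here \<open>n\<^sub>i\<close> is a unit spacelike
  vector (\<open>lorentz_principal_normal\<close>), so the norm vanishes only if its coefficient does
  (\<open>weighted_mean_curv_quadratic_exponent\<close>).

  For \<open>f u = u\<close> put \<open>W = g'\<^sup>2 - \<epsilon>\<close> and \<open>D = (\<alpha> u)\<^sup>2 + \<epsilon> (\<beta> g)\<^sup>2\<close>. The coefficient is

    \<open>(g'' D - \<epsilon> (\<alpha>\<^sup>2 u g' + \<beta>\<^sup>2 g) W) / (2 W \<surd>W D) - (\<lambda> u g' - \<mu> g) / \<surd>W = (g'' / W - A\<^sub>1) / (2 \<surd>W)\<close>,

  so being weighted minimal means \<open>g'' / W = A\<^sub>1\<close> on \<open>J\<close>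
  (\<open>weighted_mean_curv_graph_eq_0_iff\<close>). Finally \<open>g'' / W\<close> is the derivative of \<open>arctan g'\<close> when
  \<open>\<epsilon> = -1\<close>, and half the derivative of \<open>ln \<bar>(1 - g') / (1 + g')\<bar>\<close> when \<open>\<epsilon> = 1\<close>.
\<close>

lemma vector_4:
  fixes a b c d :: real
  shows "(vector [a, b, c, d] :: real ^ 4) $ 1 = a"
    and "(vector [a, b, c, d] :: real ^ 4) $ 2 = b"
    and "(vector [a, b, c, d] :: real ^ 4) $ 3 = c"
    and "(vector [a, b, c, d] :: real ^ 4) $ 4 = d"
  unfolding vector_def by simp_all

lemma frechet_derivative_quadratic_exponent:
  "frechet_derivative (quadratic_exponent lam \<mu>) (at p) w =
     2 * lam * (p $ 1 * w $ 1 + p $ 2 * w $ 2) + 2 * \<mu> * (p $ 3 * w $ 3 - p $ 4 * w $ 4)"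
proof -
  have coord: "((\<lambda>q. q $ k) has_derivative (\<lambda>w. w $ k)) (at p)" for k
    by (rule bounded_linear_imp_has_derivative[OF bounded_linear_vec_nth])
  have sq: "((\<lambda>q. (q $ k)\<^sup>2) has_derivative (\<lambda>w. 2 * (p $ k * w $ k))) (at p)" for k
    using has_derivative_mult[OF coord[of k] coord[of k]]
    by (simp add: power2_eq_square mult.commute)
  have "(quadratic_exponent lam \<mu> has_derivative
      (\<lambda>w. lam * (2 * (p $ 1 * w $ 1) + 2 * (p $ 2 * w $ 2))
         + \<mu> * (2 * (p $ 3 * w $ 3) - 2 * (p $ 4 * w $ 4)))) (at p)"
    unfolding quadratic_exponent_def
    by (intro has_derivative_add has_derivative_diff has_derivative_mult_right sq)
  from fun_cong[OF frechet_derivative_at[OF this], of w] show ?thesis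
    by argo
qed

text \<open>For \<open>j \<noteq> i\<close> the \<open>xy\<close>-part of the normal is orthogonal to the \<open>xy\<close>-part of the point, and
  likewise for the \<open>zt\<close>-parts and the Lorentzian product; so the differentials of \<open>x\<^sup>2 + y\<^sup>2\<close> and of
  \<open>z\<^sup>2 - t\<^sup>2\<close> both vanish on it.\<close>

lemma normal_other_annihilates_quadratic_exponent:
  assumes "i \<in> {1, 2}" "j \<in> {1, 2}" "j \<noteq> i"
  shows "frechet_derivative (quadratic_exponent lam \<mu>) (at (rot_surface i \<alpha> \<beta> f g u v))
           (normal i j \<alpha> \<beta> f g u v) = 0"
  using assms
  by (auto simp: frechet_derivative_quadratic_exponent rot_surface_def normal_def
      normal_first_def normal_second_def vector_4 algebra_simps)

text \<open>The Euclidean and the Lorentzian plane product of two parallel vectors, in polar form. These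
  two identities remove the parameter \<open>v\<close> from everything that involves the normal \<open>n\<^sub>i\<close>.\<close>

lemma circle_product:
  "a * cos x * (b * cos x) + a * sin x * (b * sin x) = a * b" for a b x :: real
  using sin_cos_squared_add[of x] by algebra

lemma hyperbola_product:
  "a * cosh x * (b * cosh x) - a * sinh x * (b * sinh x) = a * b" for a b x :: real
  using hyperbolic_pythagoras[of x] by algebra

text \<open>Both sign patterns of the types are covered by one formula: in the first type the sign comes
  from \<open>-f'\<close> in the normal, in the second from the exchange of \<open>cosh\<close> and \<open>sinh\<close>, which makes
  the \<open>zt\<close>-part of the surface timelike.\<close>

lemma quadratic_exponent_along_principal_normal:
  assumes "i \<in> {1, 2}"
  shows "frechet_derivative (quadratic_exponent lam \<mu>) (at (rot_surface i \<alpha> \<beta> f g u v))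
           (normal i i \<alpha> \<beta> f g u v) =
         2 * (lam * f u * deriv g u - \<mu> * g u * deriv f u)
           / sqrt (- eps i * (deriv f u)\<^sup>2 + (deriv g u)\<^sup>2)"
proof -
  define s where "s = 1 / sqrt (- eps i * (deriv f u)\<^sup>2 + (deriv g u)\<^sup>2)"
  have "frechet_derivative (quadratic_exponent lam \<mu>) (at (rot_surface i \<alpha> \<beta> f g u v))
           (normal i i \<alpha> \<beta> f g u v) =
        2 * s * (lam * (f u * deriv g u) - \<mu> * (g u * deriv f u))"
    unfolding circle_product[of "f u" "\<alpha> * v" "deriv g u", symmetric]
      hyperbola_product[of "g u" "\<beta> * v" "deriv f u", symmetric]
    using assms
    by (auto simp: s_def eps_def frechet_derivative_quadratic_exponent rot_surface_def normal_def
      normal_first_def normal_second_def vector_4 algebra_simps)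
  then show ?thesis by (simp add: s_def)
qed

lemma lorentz_scaleR: "lorentz (c *\<^sub>R n) (c *\<^sub>R n) = c\<^sup>2 * lorentz n n"
  by (simp add: lorentz_def power2_eq_square algebra_simps)

text \<open>Without the normalising factor the vector \<open>n\<^sub>i\<close> has Lorentz square \<open>-\<epsilon> f'\<^sup>2 + g'\<^sup>2\<close>: its rotating
  part contributes \<open>g'\<^sup>2\<close>, and its boosted part is spacelike for \<open>\<epsilon> = -1\<close> and timelike for
  \<open>\<epsilon> = 1\<close>.\<close>

lemma lorentz_principal_normal:
  assumes "i \<in> {1, 2}" "- eps i * (deriv f u)\<^sup>2 + (deriv g u)\<^sup>2 > 0"
  shows "lorentz (normal i i \<alpha> \<beta> f g u v) (normal i i \<alpha> \<beta> f g u v) = 1"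
proof -
  define W where "W = - eps i * (deriv f u)\<^sup>2 + (deriv g u)\<^sup>2"
  have W: "(1 / sqrt W)\<^sup>2 * W = 1"
    using assms(2) by (simp add: W_def power_divide)
  note circ = circle_product[of "deriv g u" "\<alpha> * v" "deriv g u"]
  note hyp = hyperbola_product[of "deriv f u" "\<beta> * v" "deriv f u"]
  consider "i = 1" | "i = 2" using assms(1) by auto
  then have "lorentz (normal i i \<alpha> \<beta> f g u v) (normal i i \<alpha> \<beta> f g u v) = (1 / sqrt W)\<^sup>2 * W"
  proof cases
    case 1
    then have W1: "(deriv f u)\<^sup>2 + (deriv g u)\<^sup>2 = W" by (simp add: W_def eps_def)
    have "lorentz (normal i i \<alpha> \<beta> f g u v) (normal i i \<alpha> \<beta> f g u v) = (1 / sqrt W)\<^sup>2 *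
        (deriv g u * cos (\<alpha> * v) * (deriv g u * cos (\<alpha> * v))
         + deriv g u * sin (\<alpha> * v) * (deriv g u * sin (\<alpha> * v))
         + (deriv f u * cosh (\<beta> * v) * (deriv f u * cosh (\<beta> * v))
            - deriv f u * sinh (\<beta> * v) * (deriv f u * sinh (\<beta> * v))))"
      by (simp only: 1 normal_def normal_first_def W1 lorentz_scaleR if_True refl)
        (simp add: lorentz_def vector_4)
    also have "\<dots> = (1 / sqrt W)\<^sup>2 * W"
      unfolding circ hyp W1[symmetric] by (simp add: power2_eq_square)
    finally show ?thesis .
  next
    case 2
    then have W2: "(deriv g u)\<^sup>2 - (deriv f u)\<^sup>2 = W" by (simp add: W_def eps_def)
    have "lorentz (normal i i \<alpha> \<beta> f g u v) (normal i i \<alpha> \<beta> f g u v) = (1 / sqrt W)\<^sup>2 *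
        (deriv g u * cos (\<alpha> * v) * (deriv g u * cos (\<alpha> * v))
         + deriv g u * sin (\<alpha> * v) * (deriv g u * sin (\<alpha> * v))
         - (deriv f u * cosh (\<beta> * v) * (deriv f u * cosh (\<beta> * v))
            - deriv f u * sinh (\<beta> * v) * (deriv f u * sinh (\<beta> * v))))"
      by (simp add: 2 normal_def normal_second_def W2 lorentz_scaleR)
        (simp add: lorentz_def vector_4)
    also have "\<dots> = (1 / sqrt W)\<^sup>2 * W"
      unfolding circ hyp W2[symmetric] by (simp add: power2_eq_square)
    finally show ?thesis .
  qed
  with W show ?thesis by simp
qed

text \<open>Since the weighted mean curvature vector is parallel to the unit vector \<open>n\<^sub>i\<close>, its norm is the
  absolute value of the coefficient. The right-hand side does not contain \<open>v\<close>, so minimality can be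
  tested at a single point of each orbit.\<close>

lemma weighted_mean_curv_quadratic_exponent:
  assumes "i \<in> {1, 2}" "- eps i * (deriv f u)\<^sup>2 + (deriv g u)\<^sup>2 > 0"
  shows "weighted_mean_curv (quadratic_exponent lam \<mu>) i \<alpha> \<beta> f g u v =
         \<bar>mean_curv i i \<alpha> \<beta> f g u
           - (lam * f u * deriv g u - \<mu> * g u * deriv f u)
             / sqrt (- eps i * (deriv f u)\<^sup>2 + (deriv g u)\<^sup>2)\<bar>"
    (is "_ = \<bar>?h\<bar>")
proof -
  have other: "weighted_mean_curv_fun (quadratic_exponent lam \<mu>) i j \<alpha> \<beta> f g u v = 0"
    if "j \<in> {1, 2}" "j \<noteq> i" for j
    using that normal_other_annihilates_quadratic_exponent[OF assms(1) that]
    by (simp add: weighted_mean_curv_fun_def mean_curv_def)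
  have principal: "weighted_mean_curv_fun (quadratic_exponent lam \<mu>) i i \<alpha> \<beta> f g u v = ?h"
    by (simp add: weighted_mean_curv_fun_def quadratic_exponent_along_principal_normal[OF assms(1)]
        del: right_diff_distrib_numeral)
  have "weighted_mean_curv_vector (quadratic_exponent lam \<mu>) i \<alpha> \<beta> f g u v
          = ?h *\<^sub>R normal i i \<alpha> \<beta> f g u v"
    using assms(1) other[of 1] other[of 2] principal
    by (auto simp: weighted_mean_curv_vector_def)
  then show ?thesis
    by (simp add: lorentz_scaleR weighted_mean_curv_def lorentz_norm_def lorentz_principal_normal[OF assms])
qed

text \<open>For a meridian that is a graph over the \<open>u\<close>-axis, the weighted mean curvature is
  \<open>\<bar>g'' / W - A\<^sub>1\<bar> / (2 \<surd>W)\<close> with \<open>W = g'\<^sup>2 - \<epsilon>\<close>.\<close>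

lemma weighted_mean_curv_graph_eq_0_iff:
  assumes "i \<in> {1, 2}" "f u = u" "deriv f u = 1" "deriv (deriv f) u = 0"
    and W: "(deriv g u)\<^sup>2 - eps i > 0"
    and D: "(\<alpha> * u)\<^sup>2 + eps i * (\<beta> * g u)\<^sup>2 \<noteq> 0"
  shows "weighted_mean_curv (quadratic_exponent lam \<mu>) i \<alpha> \<beta> f g u v = 0 \<longleftrightarrow>
         deriv (deriv g) u / ((deriv g u)\<^sup>2 - eps i) = A1 i lam \<mu> \<alpha> \<beta> g u"
proof -
  define w where "w = - eps i + (deriv g u)\<^sup>2"
  define d where "d = (\<alpha> * u)\<^sup>2 + eps i * (\<beta> * g u)\<^sup>2"
  define q where "q = lam * u * deriv g u - \<mu> * g u"
  define r where "r = eps i * (\<beta>\<^sup>2 * g u + \<alpha>\<^sup>2 * u * deriv g u)"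
  have w: "w > 0" and d: "d \<noteq> 0" using W D by (simp_all add: w_def d_def)
  have p32: "w powr (3 / 2) = w * sqrt w"
  proof -
    have "w powr (3 / 2) = w powr (1 + 1 / 2)" by simp
    also have "\<dots> = w * sqrt w" using w by (subst powr_add) (simp add: powr_half_sqrt)
    finally show ?thesis .
  qed
  have H: "mean_curv i i \<alpha> \<beta> f g u = (deriv (deriv g) u * d - r * w) / (2 * w powr (3 / 2) * d)"
    using assms(2-4) by (simp add: mean_curv_def w_def d_def r_def algebra_simps)
  have A: "A1 i lam \<mu> \<alpha> \<beta> g u = (2 * q * d + r) / d"
    by (simp add: A1_def q_def d_def r_def)
  have "(deriv (deriv g) u * d - r * w) / (2 * w powr (3 / 2) * d) - q / sqrt w
          = (deriv (deriv g) u / w - (2 * q * d + r) / d) / (2 * sqrt w)"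
    using w d by (simp add: p32 field_simps)
  moreover have "weighted_mean_curv (quadratic_exponent lam \<mu>) i \<alpha> \<beta> f g u v
      = \<bar>mean_curv i i \<alpha> \<beta> f g u - q / sqrt w\<bar>"
    using weighted_mean_curv_quadratic_exponent[OF assms(1), of f u g lam \<mu> \<alpha> \<beta> v] w assms(2,3)
    by (simp add: w_def q_def)
  ultimately show ?thesis using w by (simp add: H A) (simp add: w_def)
qed

lemma smooth_on_reals_deriv_has_derivative:
  assumes "smooth_on_reals J g" "open J" "u \<in> J"
  shows "(deriv g has_real_derivative deriv (deriv g) u) (at u)"
proof -
  have "(deriv ^^ 1) g differentiable_on J"
    using assms(1) unfolding smooth_on_reals_def by blast
  then have "deriv g differentiable (at u)"
    using assms(2,3) by (simp add: differentiable_on_eq_differentiable_at)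
  then show ?thesis
    by (simp add: DERIV_deriv_iff_real_differentiable)
qed

text \<open>In the second type \<open>\<bar>g'\<bar> > 1\<close>, so \<open>(1 - g') / (1 + g')\<close> is negative and the logarithm of its
  absolute value has to be differentiated at a negative argument.\<close>

lemma has_real_derivative_ln_abs_cayley:
  fixes h :: "real \<Rightarrow> real"
  assumes "(h has_real_derivative h') (at u)" "(h u)\<^sup>2 \<noteq> 1"
  shows "((\<lambda>s. ln \<bar>(1 - h s) / (1 + h s)\<bar>) has_real_derivative 2 * (h' / ((h u)\<^sup>2 - 1))) (at u)"
proof -
  have ne: "1 - h u \<noteq> 0" "1 + h u \<noteq> 0"
    using assms(2) by (auto simp: power2_eq_1_iff eq_neg_iff_add_eq_0 add.commute)
  have pr: "(h u)\<^sup>2 - 1 = - ((1 - h u) * (1 + h u))"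
    by algebra
  have quotient: "((\<lambda>s. (1 - h s) / (1 + h s)) has_real_derivative
      - 2 * h' / (1 + h u)\<^sup>2) (at u)"
    using assms(1) ne
    by (auto intro!: derivative_eq_intros simp: field_simps power2_eq_square)
  have ln_abs: "((\<lambda>y. ln \<bar>y\<bar>) has_real_derivative 1 / y) (at y)" if "y \<noteq> 0" for y :: real
  proof -
    (* The real logarithm of HOL is even, ln (-y) = ln y, which yields negative arguments. *)
    have "(ln has_real_derivative 1 / y) (at y)"
    proof (cases "y > 0")
      case True
      then show ?thesis by (rule DERIV_ln_divide)
    next
      case False
      then have "((\<lambda>y. ln (- y)) has_real_derivative 1 / y) (at y)"
        using that by (auto intro!: derivative_eq_intros)
      then show ?thesis by (simp add: ln_minus)
    qed
    moreover have "(\<lambda>y :: real. ln \<bar>y\<bar>) = ln"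
      by (auto simp: abs_if ln_minus)
    ultimately show ?thesis by simp
  qed
  have "((\<lambda>s. ln \<bar>(1 - h s) / (1 + h s)\<bar>) has_real_derivative
      1 / ((1 - h u) / (1 + h u)) * (- 2 * h' / (1 + h u)\<^sup>2)) (at u)"
    using ne by (intro DERIV_chain2[OF ln_abs quotient]) simp
  moreover have "1 / ((1 - h u) / (1 + h u)) * (- 2 * h' / (1 + h u)\<^sup>2) = 2 * (h' / ((h u)\<^sup>2 - 1))"
    unfolding pr using ne by (simp add: divide_simps power2_eq_square)
  ultimately show ?thesis by simp
qed

text \<open>The differential equation of the theorem is stated as a derivative relation; once the derivative
  is known, uniqueness turns it into an equation between numbers.\<close>

lemma has_real_derivative_iff_eq:
  assumes "(F has_real_derivative a) (at u)"
  shows "(F has_real_derivative b) (at u) \<longleftrightarrow> a = b"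
  using assms DERIV_unique by blast

theorem theorem4:
  fixes i :: nat and lam \<mu> \<alpha> \<beta> :: real and J :: "real set" and f g :: "real \<Rightarrow> real"
  assumes "i \<in> {1, 2}"
    and "\<not> (lam = 0 \<and> \<mu> = 0)"
    and "timelike_rotational i \<alpha> \<beta> J f g"
    and "\<And>u. u \<in> J \<Longrightarrow> f u = u"
  shows "weighted_minimal (quadratic_exponent lam \<mu>) i \<alpha> \<beta> J f g \<longleftrightarrow>
    (\<forall>u\<in>J.
      if i = 1
      then ((\<lambda>s. arctan (deriv g s)) has_real_derivative A1 i lam \<mu> \<alpha> \<beta> g u) (at u)
      else ((\<lambda>s. ln \<bar>(1 - deriv g s) / (1 + deriv g s)\<bar>)
              has_real_derivative 2 * A1 i lam \<mu> \<alpha> \<beta> g u) (at u))"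
proof -
  have J: "open J" and g: "smooth_on_reals J g"
    using assms(3) by (simp_all add: timelike_rotational_def)
  (* f is the identity only on J; as J is open, this suffices for both derivatives. *)
  have f1: "deriv f u = 1" if "u \<in> J" for u
  proof -
    have "deriv f u = deriv (\<lambda>u. u) u"
      using assms(4) eventually_nhds_in_open[OF J that]
      by (intro deriv_cong_ev refl) (auto elim!: eventually_mono)
    then show ?thesis by simp
  qed
  have f2: "deriv (deriv f) u = 0" if "u \<in> J" for u
  proof -
    have "deriv (deriv f) u = deriv (\<lambda>_. 1) u"
      using f1 eventually_nhds_in_open[OF J that]
      by (intro deriv_cong_ev refl) (auto elim!: eventually_mono)
    then show ?thesis by simp
  qed
  have pointwise: "weighted_mean_curv (quadratic_exponent lam \<mu>) i \<alpha> \<beta> f g u v = 0 \<longleftrightarrow>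
      (if i = 1
       then ((\<lambda>s. arctan (deriv g s)) has_real_derivative A1 i lam \<mu> \<alpha> \<beta> g u) (at u)
       else ((\<lambda>s. ln \<bar>(1 - deriv g s) / (1 + deriv g s)\<bar>)
               has_real_derivative 2 * A1 i lam \<mu> \<alpha> \<beta> g u) (at u))"
    if "u \<in> J" for u v
  proof -
    have W: "(deriv g u)\<^sup>2 - eps i > 0" and D: "(\<alpha> * u)\<^sup>2 + eps i * (\<beta> * g u)\<^sup>2 \<noteq> 0"
      using assms(1,3) assms(4)[OF that] f1[OF that] that
      by (auto simp: timelike_rotational_def eps_def power_mult_distrib split: if_splits)
    note minimal_iff = weighted_mean_curv_graph_eq_0_iff
      [OF assms(1) assms(4)[OF that] f1[OF that] f2[OF that] W D]
    note g2 = smooth_on_reals_deriv_has_derivative[OF g J that]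
    consider "i = 1" | "i = 2" using assms(1) by auto
    then show ?thesis
    proof cases
      case 1
      have "((\<lambda>s. arctan (deriv g s)) has_real_derivative
          deriv (deriv g) u / ((deriv g u)\<^sup>2 - eps i)) (at u)"
        using g2 by (auto intro!: derivative_eq_intros simp: 1 eps_def field_simps)
      from has_real_derivative_iff_eq[OF this] minimal_iff 1 show ?thesis by simp
    next
      case 2
      have "((\<lambda>s. ln \<bar>(1 - deriv g s) / (1 + deriv g s)\<bar>) has_real_derivative
          2 * (deriv (deriv g) u / ((deriv g u)\<^sup>2 - eps i))) (at u)"
        using has_real_derivative_ln_abs_cayley[OF g2] W by (simp add: 2 eps_def)
      from has_real_derivative_iff_eq[OF this, of "2 * A1 i lam \<mu> \<alpha> \<beta> g u"] minimal_iff 2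
      show ?thesis by (simp only: mult_cancel_left) simp
    qed
  qed
  (* The condition at u is free of v, so any admissible v, such as 0, recovers it. *)
  have "(0 :: real) \<in> {0..<2 * pi}" by simp
  with pointwise show ?thesis unfolding weighted_minimal_def by blast
qed

end
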